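(* Let $a\in L^1(I)$ and $\lambda\in\mathbb{R}$. Assume that $L[\lambda]$ is nonresonant in $X_D$ and that $$\Delta:=2r_1'[\lambda](1)+r_2'[\lambda](1)-r_1'[\lambda](0)\neq0.$$ Then for all $(t,s)\in I\times I$ $$G_P[\lambda](t,s)=G_D[\lambda](t,s)+\frac{r_1[\lambda](t)+r_2[\lambda](t)}{\Delta}\Big(\frac{\partial}{\partial t}G_D[\lambda](0,s)-\frac{\partial}{\partial t}G_D[\lambda](1,s)\Big)$$ $$=G_D[\lambda](t,s)+\frac{\frac{\partial}{\partial s}G_D[\lambda](t,1)-\frac{\partial}{\partial s}G_D[\lambda](t,0)}{\Delta}\Big(\frac{\partial}{\partial t}G_D[\lambda](0,s)-\frac{\partial}{\partial t}G_D[\lambda](1,s)\Big).$$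
   Context: $I=[0,1]$, $a\in L^1(I)$ is real-valued, $\lambda\in\mathbb{R}$, and $L[\lambda]u(t)=u''(t)+(a(t)+\lambda)u(t)$. $W^{2,1}(I)=\{u\in C(I):u'\in AC(I)\}$, where $AC(I)$ is the set of absolutely continuous functions on $I$. $X_D=\{u\in W^{2,1}(I):u(0)=u(1)=0\}$ (Dirichlet) and $X_P=\{u\in W^{2,1}(I):u(0)=u(1),\,u'(0)=u'(1)\}$ (periodic). $L[\lambda]$ is nonresonant in $X$ if $u=0$ is the only $u\in X$ with $L[\lambda]u=0$ a.e. on $I$. In that case, for every $\sigma\in L^1(I)$ the problem $L[\lambda]u=\sigma$ a.e. on $I$, $u\in X$, has a unique solution, given by $u(t)=\int_0^1G(t,s)\sigma(s)\,ds$, where the continuous function $G:I\times I\to\mathbb{R}$ is the Green's function; it is denoted $G_D[\lambda]$ for $X=X_D$ and $G_P[\lambda]$ for $X=X_P$ (the latter exists under the hypotheses of the claim). $r_1[\lambda]$ is the unique solution of $L[\lambda]u=0$ a.e. on $I$, $u(0)=1$, $u(1)=0$; $r_2[\lambda]$ is the unique solution of $L[\lambda]u=0$ a.e. on $I$, $u(0)=0$, $u(1)=1$; primes denote derivatives in $t$. Convention: $\frac{\partial}{\partial s}G(t,0)$, $\frac{\partial}{\partial s}G(t,1)$ are (one-sided) derivatives in the second variable for $t\in(0,1)$, extended by continuity to $t\in\{0,1\}$; $\frac{\partial}{\partial t}G(0,s)$, $\frac{\partial}{\partial t}G(1,s)$ are one-sided derivatives in the first variable for $s\in(0,1)$, extended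 by continuity to $s\in\{0,1\}$. *)

theory Defs
  imports "HOL-Analysis.Analysis"
begin

text \<open>Functions on \<open>I = [0,1]\<close> are represented by functions \<open>real \<Rightarrow> real\<close>; every notion below
  depends only on their values on \<open>I\<close>, and equality of functions is meant pointwise on \<open>I\<close>.\<close>

abbreviation I01 :: "real set" where
  "I01 \<equiv> {0..1}"

text \<open>The derivative relative to \<open>I\<close>, hence one-sided at the endpoints.\<close>

definition ider :: "(real \<Rightarrow> real) \<Rightarrow> real \<Rightarrow> real" where
  "ider u t = vector_derivative u (at t within I01)"

text \<open>A \<open>division_of\<close> its own union is a finite family of nonoverlapping nonempty compact intervals
  \<open>[Inf k, Sup k]\<close>.\<close>

definition abs_continuous_on :: "real set \<Rightarrow> (real \<Rightarrow> real) \<Rightarrow> bool" where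
  "abs_continuous_on S f \<longleftrightarrow>
     (\<forall>\<epsilon>>0. \<exists>\<delta>>0. \<forall>d. d division_of \<Union>d \<and> \<Union>d \<subseteq> S \<and> (\<Sum>k\<in>d. Sup k - Inf k) < \<delta> \<longrightarrow>
        (\<Sum>k\<in>d. \<bar>f (Sup k) - f (Inf k)\<bar>) < \<epsilon>)"

definition W21 :: "(real \<Rightarrow> real) set" where
  "W21 = {u. continuous_on I01 u \<and> u differentiable_on I01 \<and> abs_continuous_on I01 (ider u)}"

definition X_D :: "(real \<Rightarrow> real) set" where
  "X_D = {u \<in> W21. u 0 = 0 \<and> u 1 = 0}"

definition X_P :: "(real \<Rightarrow> real) set" where
  "X_P = {u \<in> W21. u 0 = u 1 \<and> ider u 0 = ider u 1}"

text \<open>\<open>L[\<lambda>]u = \<sigma>\<close> almost everywhere on \<open>I\<close>, i.e. for almost every \<open>t\<close> the second derivative of \<open>u\<close>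
  exists and \<open>u''(t) + (a(t) + \<lambda>) u(t) = \<sigma>(t)\<close>.\<close>

definition solves_ae ::
    "(real \<Rightarrow> real) \<Rightarrow> real \<Rightarrow> (real \<Rightarrow> real) \<Rightarrow> (real \<Rightarrow> real) \<Rightarrow> bool" where
  "solves_ae a lam \<sigma> u \<longleftrightarrow>
     (AE t in lebesgue. t \<in> I01 \<longrightarrow>
        (\<exists>u2. (ider u has_real_derivative u2) (at t within I01) \<and>
              u2 + (a t + lam) * u t = \<sigma> t))"

definition nonresonant :: "(real \<Rightarrow> real) set \<Rightarrow> (real \<Rightarrow> real) \<Rightarrow> real \<Rightarrow> bool" where
  "nonresonant X a lam \<longleftrightarrow>
     (\<forall>u\<in>X. solves_ae a lam (\<lambda>_. 0) u \<longrightarrow> (\<forall>t\<in>I01. u t = 0))"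

text \<open>Since \<open>G\<close> is continuous, these properties determine it uniquely on \<open>I \<times> I\<close>.\<close>

definition is_greens_function ::
    "(real \<Rightarrow> real) set \<Rightarrow> (real \<Rightarrow> real) \<Rightarrow> real \<Rightarrow> (real \<Rightarrow> real \<Rightarrow> real) \<Rightarrow> bool" where
  "is_greens_function X a lam G \<longleftrightarrow>
     continuous_on (I01 \<times> I01) (\<lambda>(t, s). G t s) \<and>
     (\<forall>\<sigma>. \<sigma> absolutely_integrable_on I01 \<longrightarrow>
        (\<lambda>t. LINT s:I01|lebesgue. G t s * \<sigma> s) \<in> X \<and>
        solves_ae a lam \<sigma> (\<lambda>t. LINT s:I01|lebesgue. G t s * \<sigma> s) \<and>
        (\<forall>u\<in>X. solves_ae a lam \<sigma> u \<longrightarrow>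
           (\<forall>t\<in>I01. u t = (LINT s:I01|lebesgue. G t s * \<sigma> s))))"

text \<open>A function given on the open interval \<open>(0,1)\<close>, extended by continuity to the endpoints.\<close>

definition cont_ext :: "(real \<Rightarrow> real) \<Rightarrow> real \<Rightarrow> real" where
  "cont_ext f x = (if x \<in> {0<..<1} then f x else Lim (at x within {0<..<1}) f)"

text \<open>Intended for \<open>\<tau> \<in> {0,1}\<close>: the derivative of \<open>G\<close> in the first (resp. second) variable at
  \<open>\<tau>\<close>, one-sided for the other variable in \<open>(0,1)\<close> and extended by continuity otherwise.\<close>

definition bdry_deriv_t :: "(real \<Rightarrow> real \<Rightarrow> real) \<Rightarrow> real \<Rightarrow> real \<Rightarrow> real" where
  "bdry_deriv_t G \<tau> s = cont_ext (\<lambda>s'. ider (\<lambda>t. G t s') \<tau>) s"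

definition bdry_deriv_s :: "(real \<Rightarrow> real \<Rightarrow> real) \<Rightarrow> real \<Rightarrow> real \<Rightarrow> real" where
  "bdry_deriv_s G t \<tau> = cont_ext (\<lambda>t'. ider (\<lambda>s. G t' s) \<tau>) t"

end

theory Submission
  imports Defs
begin

text \<open>
  Write \<open>L u = u'' + (a + \<lambda>) u\<close> and \<open>w = r1 + r2\<close>, the homogeneous solution with \<open>w(0) = w(1) = 1\<close>.
  If \<open>u\<close> solves the Dirichlet problem for \<open>\<sigma>\<close>, then \<open>u - c w\<close> still solves \<open>L v = \<sigma>\<close> and takes equal
  values at both endpoints, so it is the periodic solution as soon as \<open>c\<close> is chosen to close the gap
  \<open>u'(1) - u'(0)\<close> between the slopes.  The slope of \<open>w\<close> jumps by \<open>\<Delta>\<close> and, by Lagrange's identity, that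
  of \<open>u\<close> jumps by the integral of \<open>w \<sigma>\<close>; hence \<open>c\<close> is this integral divided by \<open>\<Delta>\<close>, and
  \<open>G_P(t,s) = G_D(t,s) - w(t) w(s) / \<Delta>\<close> (lemma \<open>periodic_greens_function\<close>).

  What remains is to recognise \<open>w\<close> in the boundary derivatives of \<open>G_D\<close>.  Lagrange's identity for
  \<open>u, r2\<close> on \<open>[0,t]\<close> and for \<open>u, r1\<close> on \<open>[t,1]\<close>, combined so as to eliminate \<open>u'(t)\<close>, gives
  \<open>G_D(t,s) = - r1(max t s) r2(min t s) / W\<close> with the Wronskian \<open>W = r2'(0) = - r1'(1)\<close>
  (lemmas \<open>dirichlet_representation\<close> and \<open>dirichlet_greens_function_eq\<close>).  Differentiating this symmetric
  kernel at the boundary yields \<open>- r1\<close> at \<open>0\<close> and \<open>r2\<close> at \<open>1\<close> in either variable, so both formulas of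
  the theorem equal the kernel above.  Dividing by \<open>W\<close> is legitimate because \<open>r2\<close> would otherwise have
  zero initial data and vanish (lemma \<open>zero_initial_data_imp_zero\<close>).

  Since the second derivatives exist only almost everywhere, Lagrange's identity rests on the
  fundamental theorem of calculus for absolutely continuous functions, which is proved first, by
  Henstock--Kurzweil sums.
\<close>

section \<open>Absolutely continuous functions\<close>

lemma abs_continuous_onD:
  assumes "abs_continuous_on S f" "\<epsilon> > 0"
  obtains \<delta> where "\<delta> > 0" "\<And>d. \<lbrakk>d division_of \<Union>d; \<Union>d \<subseteq> S; (\<Sum>k\<in>d. Sup k - Inf k) < \<delta>\<rbrakk>
      \<Longrightarrow> (\<Sum>k\<in>d. \<bar>f (Sup k) - f (Inf k)\<bar>) < \<epsilon>"
proof -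
  obtain \<delta> where \<delta>: "\<delta> > 0 \<and> (\<forall>d. d division_of \<Union>d \<and> \<Union>d \<subseteq> S \<and> (\<Sum>k\<in>d. Sup k - Inf k) < \<delta> \<longrightarrow>
        (\<Sum>k\<in>d. \<bar>f (Sup k) - f (Inf k)\<bar>) < \<epsilon>)"
    using assms(1)[unfolded abs_continuous_on_def, THEN spec, THEN mp, OF assms(2)] by (elim exE)
  show ?thesis
    by (rule that[of \<delta>]) (use \<delta> in simp_all)
qed

lemma division_endpoints:
  fixes d :: "real set set"
  assumes "d division_of T" "k \<in> d"
  shows "Inf k \<in> T" "Sup k \<in> T" "Inf k \<le> Sup k" "k = {Inf k..Sup k}"
proof -
  obtain u v where k: "k = cbox u v" "k \<noteq> {}" "k \<subseteq> T"
    using division_ofD(2,3,4)[OF assms(1)] assms(2) by metis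
  then have "u \<le> v" by auto
  with k show "Inf k \<in> T" "Sup k \<in> T" "Inf k \<le> Sup k" "k = {Inf k..Sup k}"
    by auto
qed

lemma abs_continuous_on_subset:
  assumes "abs_continuous_on S f" "T \<subseteq> S"
  shows "abs_continuous_on T f"
  unfolding abs_continuous_on_def
proof (intro allI impI)
  fix \<epsilon> :: real assume "\<epsilon> > 0"
  then obtain \<delta> where \<delta>: "\<delta> > 0" "\<And>d. \<lbrakk>d division_of \<Union>d; \<Union>d \<subseteq> S; (\<Sum>k\<in>d. Sup k - Inf k) < \<delta>\<rbrakk>
      \<Longrightarrow> (\<Sum>k\<in>d. \<bar>f (Sup k) - f (Inf k)\<bar>) < \<epsilon>"
    using abs_continuous_onD[OF assms(1)] by blast
  then show "\<exists>\<delta>>0. \<forall>d. d division_of \<Union>d \<and> \<Union>d \<subseteq> T \<and> (\<Sum>k\<in>d. Sup k - Inf k) < \<delta> \<longrightarrow>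
        (\<Sum>k\<in>d. \<bar>f (Sup k) - f (Inf k)\<bar>) < \<epsilon>"
    using assms(2) by (intro exI[of _ \<delta>]) (auto intro: order_trans)
qed

text \<open>The common source of all closure properties below: a function whose increments are bounded by
  those of two absolutely continuous functions is absolutely continuous.  Linear combinations,
  products, Lipschitz functions (dominated by the identity) and functions that agree on the set are
  all instances.\<close>

lemma abs_continuous_on_dominated:
  assumes f: "abs_continuous_on S f" and g: "abs_continuous_on S g"
    and le: "\<And>x y. \<lbrakk>x \<in> S; y \<in> S\<rbrakk> \<Longrightarrow> \<bar>h y - h x\<bar> \<le> A * \<bar>f y - f x\<bar> + B * \<bar>g y - g x\<bar>"
  shows "abs_continuous_on S h"
  unfolding abs_continuous_on_def
proof (intro allI impI)
  fix \<epsilon> :: real assume "\<epsilon> > 0"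
  define C where "C = \<bar>A\<bar> + \<bar>B\<bar> + 1"
  have C: "C > 0" "A \<le> C" "B \<le> C" by (auto simp: C_def)
  have e: "\<epsilon> / (2 * C) > 0" using \<open>\<epsilon> > 0\<close> C by simp
  obtain d1 where d1: "d1 > 0" "\<And>d. \<lbrakk>d division_of \<Union>d; \<Union>d \<subseteq> S; (\<Sum>k\<in>d. Sup k - Inf k) < d1\<rbrakk>
      \<Longrightarrow> (\<Sum>k\<in>d. \<bar>f (Sup k) - f (Inf k)\<bar>) < \<epsilon> / (2 * C)"
    using abs_continuous_onD[OF f e] by blast
  obtain d2 where d2: "d2 > 0" "\<And>d. \<lbrakk>d division_of \<Union>d; \<Union>d \<subseteq> S; (\<Sum>k\<in>d. Sup k - Inf k) < d2\<rbrakk>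
      \<Longrightarrow> (\<Sum>k\<in>d. \<bar>g (Sup k) - g (Inf k)\<bar>) < \<epsilon> / (2 * C)"
    using abs_continuous_onD[OF g e] by blast
  show "\<exists>\<delta>>0. \<forall>d. d division_of \<Union>d \<and> \<Union>d \<subseteq> S \<and> (\<Sum>k\<in>d. Sup k - Inf k) < \<delta> \<longrightarrow>
        (\<Sum>k\<in>d. \<bar>h (Sup k) - h (Inf k)\<bar>) < \<epsilon>"
  proof (intro exI[of _ "min d1 d2"] conjI allI impI)
    fix d :: "real set set"
    assume d: "d division_of \<Union>d \<and> \<Union>d \<subseteq> S \<and> (\<Sum>k\<in>d. Sup k - Inf k) < min d1 d2"
    have "(\<Sum>k\<in>d. \<bar>h (Sup k) - h (Inf k)\<bar>)
        \<le> (\<Sum>k\<in>d. C * \<bar>f (Sup k) - f (Inf k)\<bar> + C * \<bar>g (Sup k) - g (Inf k)\<bar>)"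
    proof (rule sum_mono)
      fix k assume k: "k \<in> d"
      have "Inf k \<in> S" "Sup k \<in> S"
        using division_endpoints(1,2)[of d "\<Union>d" k] d k by auto
      from le[OF this]
      have "\<bar>h (Sup k) - h (Inf k)\<bar> \<le> A * \<bar>f (Sup k) - f (Inf k)\<bar> + B * \<bar>g (Sup k) - g (Inf k)\<bar>" .
      also have "\<dots> \<le> C * \<bar>f (Sup k) - f (Inf k)\<bar> + C * \<bar>g (Sup k) - g (Inf k)\<bar>"
        using C by (intro add_mono mult_right_mono) auto
      finally show "\<bar>h (Sup k) - h (Inf k)\<bar> \<le> C * \<bar>f (Sup k) - f (Inf k)\<bar> + C * \<bar>g (Sup k) - g (Inf k)\<bar>" .
    qed
    also have "\<dots> = C * (\<Sum>k\<in>d. \<bar>f (Sup k) - f (Inf k)\<bar>) + C * (\<Sum>k\<in>d. \<bar>g (Sup k) - g (Inf k)\<bar>)"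
      by (simp add: sum.distrib sum_distrib_left)
    also have "\<dots> < C * (\<epsilon> / (2 * C)) + C * (\<epsilon> / (2 * C))"
      using d C by (intro add_strict_mono mult_strict_left_mono d1(2) d2(2)) auto
    also have "\<dots> = \<epsilon>" using C by simp
    finally show "(\<Sum>k\<in>d. \<bar>h (Sup k) - h (Inf k)\<bar>) < \<epsilon>" .
  qed (use d1 d2 in auto)
qed

lemma abs_continuous_on_lincomb:
  assumes "abs_continuous_on S f" "abs_continuous_on S g"
  shows "abs_continuous_on S (\<lambda>x. c * f x + d * g x)"
proof (rule abs_continuous_on_dominated[OF assms, of _ "\<bar>c\<bar>" "\<bar>d\<bar>"])
  fix x y
  have "(c * f y + d * g y) - (c * f x + d * g x) = c * (f y - f x) + d * (g y - g x)"
    by (simp add: algebra_simps)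
  then show "\<bar>(c * f y + d * g y) - (c * f x + d * g x)\<bar> \<le> \<bar>c\<bar> * \<bar>f y - f x\<bar> + \<bar>d\<bar> * \<bar>g y - g x\<bar>"
    by (metis abs_mult abs_triangle_ineq)
qed

lemma abs_continuous_on_cong:
  assumes "abs_continuous_on S f" "\<And>x. x \<in> S \<Longrightarrow> g x = f x"
  shows "abs_continuous_on S g"
  by (rule abs_continuous_on_dominated[OF assms(1) assms(1), where A = 1 and B = 0]) (simp add: assms(2))

lemma lipschitz_imp_abs_continuous_on:
  fixes f :: "real \<Rightarrow> real"
  assumes "\<And>x y. \<lbrakk>x \<in> S; y \<in> S\<rbrakk> \<Longrightarrow> \<bar>f y - f x\<bar> \<le> M * \<bar>y - x\<bar>"
  shows "abs_continuous_on S f"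
proof (rule abs_continuous_on_dominated[of S id id])
  show id: "abs_continuous_on S id"
    unfolding abs_continuous_on_def
  proof (intro allI impI)
    fix \<epsilon> :: real assume "\<epsilon> > 0"
    have "(\<Sum>k\<in>d. \<bar>id (Sup k) - id (Inf k)\<bar>) = (\<Sum>k\<in>d. Sup k - Inf k)"
      if "d division_of \<Union>d" for d :: "real set set"
      using division_endpoints(3)[OF that] by (intro sum.cong) auto
    with \<open>\<epsilon> > 0\<close> show "\<exists>\<delta>>0. \<forall>d. d division_of \<Union>d \<and> \<Union>d \<subseteq> S \<and> (\<Sum>k\<in>d. Sup k - Inf k) < \<delta> \<longrightarrow>
        (\<Sum>k\<in>d. \<bar>id (Sup k) - id (Inf k)\<bar>) < \<epsilon>" by (intro exI[of _ \<epsilon>]) auto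
  qed
  show "abs_continuous_on S id" by (fact id)
  show "\<bar>f y - f x\<bar> \<le> M * \<bar>id y - id x\<bar> + 0 * \<bar>id y - id x\<bar>" if "x \<in> S" "y \<in> S" for x y
    using assms[OF that] by simp
qed

lemma abs_continuous_on_imp_continuous_on:
  assumes f: "abs_continuous_on {a..b} f"
  shows "continuous_on {a..b} f"
  unfolding continuous_on_iff
proof (intro ballI allI impI)
  fix x \<epsilon> :: real assume x: "x \<in> {a..b}" and "\<epsilon> > 0"
  obtain \<delta> where \<delta>: "\<delta> > 0" "\<And>d. \<lbrakk>d division_of \<Union>d; \<Union>d \<subseteq> {a..b}; (\<Sum>k\<in>d. Sup k - Inf k) < \<delta>\<rbrakk>
      \<Longrightarrow> (\<Sum>k\<in>d. \<bar>f (Sup k) - f (Inf k)\<bar>) < \<epsilon>"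
    using abs_continuous_onD[OF f \<open>\<epsilon> > 0\<close>] by blast
  have *: "\<bar>f v - f u\<bar> < \<epsilon>" if "u \<in> {a..b}" "v \<in> {a..b}" "u \<le> v" "v - u < \<delta>" for u v
  proof -
    have "{{u..v}} division_of \<Union>{{u..v}}"
      using that division_of_self[of u v] by auto
    from \<delta>(2)[OF this] show ?thesis using that by auto
  qed
  show "\<exists>d>0. \<forall>x'\<in>{a..b}. dist x' x < d \<longrightarrow> dist (f x') (f x) < \<epsilon>"
  proof (intro exI[of _ \<delta>] conjI ballI impI \<delta>(1))
    fix y assume "y \<in> {a..b}" "dist y x < \<delta>"
    then show "dist (f y) (f x) < \<epsilon>"
      using *[of x y] *[of y x] x by (cases "x \<le> y") (auto simp: dist_real_def)
  qed
qed

lemma abs_continuous_on_mult: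
  assumes f: "abs_continuous_on {a..b} f" and g: "abs_continuous_on {a..b} g"
  shows "abs_continuous_on {a..b} (\<lambda>x. f x * g x)"
proof -
  have "bounded (f ` {a..b})" "bounded (g ` {a..b})"
    using f g by (simp_all add: abs_continuous_on_imp_continuous_on compact_continuous_image
        compact_imp_bounded)
  then obtain A B where A: "\<And>x. x \<in> {a..b} \<Longrightarrow> \<bar>f x\<bar> \<le> A" and B: "\<And>x. x \<in> {a..b} \<Longrightarrow> \<bar>g x\<bar> \<le> B"
    unfolding bounded_iff by (metis imageI real_norm_def)
  show ?thesis
  proof (rule abs_continuous_on_dominated[OF f g, of _ B A])
    fix x y assume xy: "x \<in> {a..b}" "y \<in> {a..b}"
    have "f y * g y - f x * g x = (f y - f x) * g y + f x * (g y - g x)"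
      by (simp add: algebra_simps)
    also have "\<bar>\<dots>\<bar> \<le> \<bar>g y\<bar> * \<bar>f y - f x\<bar> + \<bar>f x\<bar> * \<bar>g y - g x\<bar>"
      by (metis abs_mult abs_triangle_ineq mult.commute)
    also have "\<dots> \<le> B * \<bar>f y - f x\<bar> + A * \<bar>g y - g x\<bar>"
      using A B xy by (intro add_mono mult_right_mono) auto
    finally show "\<bar>f y * g y - f x * g x\<bar> \<le> B * \<bar>f y - f x\<bar> + A * \<bar>g y - g x\<bar>" .
  qed
qed

text \<open>Nonoverlapping intervals have total length equal to the measure of their union.  This turns the
  smallness of an open set into the bound on lengths that absolute continuity asks for.\<close>

lemma division_sum_length:
  fixes d :: "real set set"
  assumes "d division_of S"
  shows "S \<in> lmeasurable" "(\<Sum>k\<in>d. Sup k - Inf k) = measure lebesgue S"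
proof -
  show S: "S \<in> lmeasurable"
    using assms by (rule lmeasurable_division)
  have "((\<lambda>_. 1::real) has_integral (Sup k - Inf k)) k" if "k \<in> d" for k
  proof -
    have "((\<lambda>_. 1::real) has_integral (Sup k - Inf k)) {Inf k..Sup k}"
      using has_integral_const_real[of "1::real" "Inf k" "Sup k"] division_endpoints(3)[OF assms that] by simp
    then show ?thesis using division_endpoints(4)[OF assms that] by simp
  qed
  from has_integral_combine_division[OF assms this]
  have "((\<lambda>_. 1::real) has_integral (\<Sum>k\<in>d. Sup k - Inf k)) S" .
  then show "(\<Sum>k\<in>d. Sup k - Inf k) = measure lebesgue S"
    using lmeasure_integral[OF S] by (simp add: integral_unique)
qed

text \<open>An interval that contains \<open>x\<close> is better than two arbitrary points near \<open>x\<close>: splitting the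
  increment at \<open>x\<close>, the two errors add up to a multiple of the length of the interval itself.\<close>

lemma straddle_estimate:
  fixes F :: "real \<Rightarrow> real"
  assumes "(F has_real_derivative D) (at x within S)" "\<eta> > 0"
  obtains r where "r > 0"
    "\<And>u v. \<lbrakk>u \<in> S; v \<in> S; u \<le> x; x \<le> v; \<bar>u - x\<bar> < r; \<bar>v - x\<bar> < r\<rbrakk>
        \<Longrightarrow> \<bar>(v - u) * D - (F v - F u)\<bar> \<le> \<eta> * (v - u)"
proof -
  have "(F has_derivative (\<lambda>h. D * h)) (at x within S)"
    using assms(1) by (simp add: has_field_derivative_def)
  then obtain r where r: "r > 0" "\<And>y. \<lbrakk>y \<in> S; \<bar>y - x\<bar> < r\<rbrakk> \<Longrightarrow> \<bar>F y - F x - D * (y - x)\<bar> \<le> \<eta> * \<bar>y - x\<bar>"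
    using assms(2) unfolding has_derivative_within_alt real_norm_def by metis
  show ?thesis
  proof (rule that[OF r(1)])
    fix u v assume uv: "u \<in> S" "v \<in> S" "u \<le> x" "x \<le> v" "\<bar>u - x\<bar> < r" "\<bar>v - x\<bar> < r"
    have "\<bar>(v - u) * D - (F v - F u)\<bar>
        = \<bar>(F u - F x - D * (u - x)) - (F v - F x - D * (v - x))\<bar>"
      by (simp add: algebra_simps)
    also have "\<dots> \<le> \<bar>F u - F x - D * (u - x)\<bar> + \<bar>F v - F x - D * (v - x)\<bar>"
      by (rule abs_triangle_ineq4)
    also have "\<dots> \<le> \<eta> * \<bar>u - x\<bar> + \<eta> * \<bar>v - x\<bar>"
      using uv by (intro add_mono r(2)) auto
    also have "\<dots> = \<eta> * (v - u)"
      using uv by (simp add: algebra_simps)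
    finally show "\<bar>(v - u) * D - (F v - F u)\<bar> \<le> \<eta> * (v - u)" .
  qed
qed

text \<open>Put \<open>f = 0\<close> on the exceptional null set \<open>N\<close>, which changes no integral.  A Riemann sum for \<open>f\<close> then
  differs from \<open>F b - F a\<close> in two ways.  On intervals tagged outside \<open>N\<close> the error is a small
  multiple of the length, as for a differentiable function.  Intervals tagged in \<open>N\<close> are forced by
  the gauge into an open set of small measure, so absolute continuity makes the total increment of
  \<open>F\<close> over them small.\<close>

theorem fundamental_theorem_of_calculus_abs_continuous:
  fixes F f :: "real \<Rightarrow> real"
  assumes ab: "a \<le> b" and N: "negligible N" and F: "abs_continuous_on {a..b} F"
    and der: "\<And>t. t \<in> {a..b} - N \<Longrightarrow> (F has_real_derivative f t) (at t within {a..b})"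
  shows "(f has_integral (F b - F a)) {a..b}"
proof -
  define g where "g = (\<lambda>t. if t \<in> N then 0 else f t)"
  have "(g has_integral (F b - F a)) {a..b}"
    unfolding has_integral_real
  proof (intro allI impI)
    fix \<epsilon> :: real assume "\<epsilon> > 0"
    \<comment> \<open>Adding 1 to the length keeps the denominator positive when \<open>a = b\<close>.\<close>
    define \<eta> where "\<eta> = \<epsilon> / (2 * (b - a + 1))"
    have \<eta>: "\<eta> > 0" "\<eta> * (b - a) \<le> \<epsilon> / 2"
      using \<open>\<epsilon> > 0\<close> ab by (auto simp: \<eta>_def field_simps)
    obtain \<delta> where \<delta>: "\<delta> > 0" "\<And>d. \<lbrakk>d division_of \<Union>d; \<Union>d \<subseteq> {a..b}; (\<Sum>k\<in>d. Sup k - Inf k) < \<delta>\<rbrakk>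
      \<Longrightarrow> (\<Sum>k\<in>d. \<bar>F (Sup k) - F (Inf k)\<bar>) < \<epsilon> / 2"
      using abs_continuous_onD[OF F half_gt_zero[OF \<open>\<epsilon> > 0\<close>]] by blast
    have Nnull: "N \<in> null_sets lebesgue"
      using N by (simp add: negligible_iff_null_sets)
    then obtain U where U: "open U" "N \<subseteq> U" "U - N \<in> lmeasurable" "emeasure lebesgue (U - N) < ennreal \<delta>"
      using sets_lebesgue_outer_open[of N \<delta>] \<delta>(1) by (metis null_setsD2)
    have mU: "U \<in> lmeasurable" "measure lebesgue U < \<delta>"
    proof -
      have "emeasure lebesgue U = emeasure lebesgue (U - N)"
        using emeasure_Diff_null_set[OF Nnull] U(1) by simp
      with U(4) have lt: "emeasure lebesgue U < ennreal \<delta>" by simp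
      then have fin: "emeasure lebesgue U < \<infinity>"
        using ennreal_less_top less_trans by fastforce
      then show "U \<in> lmeasurable"
        using U(1) by (simp add: fmeasurable_def)
      show "measure lebesgue U < \<delta>"
        using lt fin \<delta>(1) by (simp add: emeasure_eq_ennreal_measure ennreal_less_iff)
    qed
    have "\<forall>t. \<exists>r>0. t \<in> {a..b} - N \<longrightarrow> (\<forall>u\<in>{a..b}. \<forall>v\<in>{a..b}. u \<le> t \<longrightarrow> t \<le> v \<longrightarrow> \<bar>u - t\<bar> < r \<longrightarrow> \<bar>v - t\<bar> < r
        \<longrightarrow> \<bar>(v - u) * f t - (F v - F u)\<bar> \<le> \<eta> * (v - u))"
      using straddle_estimate[OF der \<eta>(1)] by (metis zero_less_one)
    then obtain r where r: "\<And>t. r t > 0" "\<And>t u v. \<lbrakk>t \<in> {a..b} - N; u \<in> {a..b}; v \<in> {a..b}; u \<le> t; t \<le> v;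
        \<bar>u - t\<bar> < r t; \<bar>v - t\<bar> < r t\<rbrakk> \<Longrightarrow> \<bar>(v - u) * f t - (F v - F u)\<bar> \<le> \<eta> * (v - u)"
      by metis
    \<comment> \<open>On \<open>N\<close> the gauge is one and the same open set, so that all intervals tagged there lie inside it.\<close>
    define \<gamma> where "\<gamma> t = (if t \<in> N then U else ball t (r t))" for t
    have "gauge \<gamma>"
      using U(1,2) r(1) by (auto simp: gauge_def \<gamma>_def)
    moreover have "norm ((\<Sum>(x, k)\<in>p. measure lborel k *\<^sub>R g x) - (F b - F a)) < \<epsilon>"
      if p: "p tagged_division_of {a..b}" "\<gamma> fine p" for p
    proof -
      have fin: "finite p" using p(1) by blast
      have pk: "x \<in> k \<and> k \<subseteq> {a..b} \<and> k = {Inf k..Sup k} \<and> Inf k \<le> Sup k \<and> measure lborel k = Sup k - Inf k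
          \<and> Inf k \<in> {a..b} \<and> Sup k \<in> {a..b} \<and> k \<subseteq> \<gamma> x" if "(x, k) \<in> p" for x k
      proof -
        have k: "k \<in> snd ` p" using that by force
        have "x \<in> k" "k \<subseteq> {a..b}" "k \<subseteq> \<gamma> x"
          using tagged_division_ofD(2,3)[OF p(1) that] p(2) that unfolding fine_def by auto
        moreover note division_endpoints[OF division_of_tagged_division[OF p(1)] k]
        moreover from this have "measure lborel k = Sup k - Inf k" by (metis content_real)
        ultimately show ?thesis by blast
      qed
      define q where "q = {z \<in> p. fst z \<in> N}"
      have q: "q \<subseteq> p" by (auto simp: q_def)
      have qpart: "q tagged_partial_division_of {a..b}"
        using p(1) tagged_partial_division_subset[OF _ q] unfolding tagged_division_of_def by simp
      define d where "d = snd ` q"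
      have ddiv: "d division_of \<Union>d"
        unfolding d_def by (rule partial_division_of_tagged_division[OF qpart])
      have dsub: "\<Union>d \<subseteq> {a..b}" "\<Union>d \<subseteq> U"
      proof -
        have "k \<subseteq> {a..b} \<and> k \<subseteq> U" if "(x, k) \<in> q" for x k
          using pk[of x k] that by (simp add: q_def \<gamma>_def)
        then show "\<Union>d \<subseteq> {a..b}" "\<Union>d \<subseteq> U" by (fastforce simp: d_def)+
      qed
      have len: "(\<Sum>k\<in>d. Sup k - Inf k) < \<delta>"
      proof -
        have "(\<Sum>k\<in>d. Sup k - Inf k) \<le> measure lebesgue U"
          using division_sum_length[OF ddiv] measure_mono_fmeasurable[OF dsub(2) _ mU(1)]
          by (simp add: fmeasurableD)
        with mU(2) show ?thesis by simp
      qed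
      \<comment> \<open>Cutting off at the empty set is needed because \<open>F (Sup {}) - F (Inf {})\<close> is unspecified, whereas
        the passage from tagged to untagged sums requires degenerate and empty
        intervals to contribute zero.\<close>
      define var where "var k = (if k = {} then 0 else \<bar>F (Sup k) - F (Inf k)\<bar>)" for k
      have "(\<Sum>(x, k)\<in>q. \<bar>F (Sup k) - F (Inf k)\<bar>) = (\<Sum>(x, k)\<in>q. var k)"
        using tagged_partial_division_ofD(2)[OF qpart] by (intro sum.cong) (fastforce simp: var_def)+
      also have "\<dots> = (\<Sum>k\<in>d. var k)"
        unfolding d_def
        by (rule sum.over_tagged_division_lemma[OF tagged_partial_division_of_Union_self[OF qpart]])
          (auto simp: var_def)
      also have "\<dots> = (\<Sum>k\<in>d. \<bar>F (Sup k) - F (Inf k)\<bar>)"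
        using division_ofD(3)[OF ddiv] by (intro sum.cong) (auto simp: var_def)
      also have "\<dots> < \<epsilon> / 2"
        using \<delta>(2)[OF ddiv dsub(1) len] .
      finally have sq: "(\<Sum>(x, k)\<in>q. \<bar>F (Sup k) - F (Inf k)\<bar>) < \<epsilon> / 2" .
      have "(\<Sum>(x, k)\<in>q. \<bar>measure lborel k *\<^sub>R g x - (F (Sup k) - F (Inf k))\<bar>)
          = (\<Sum>(x, k)\<in>q. \<bar>F (Sup k) - F (Inf k)\<bar>)"
        by (intro sum.cong) (auto simp: q_def g_def)
      with sq have sq': "(\<Sum>(x, k)\<in>q. \<bar>measure lborel k *\<^sub>R g x - (F (Sup k) - F (Inf k))\<bar>) < \<epsilon> / 2"
        by simp
      have "(\<Sum>(x, k)\<in>p - q. \<bar>measure lborel k *\<^sub>R g x - (F (Sup k) - F (Inf k))\<bar>)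
          \<le> (\<Sum>(x, k)\<in>p - q. \<eta> * (Sup k - Inf k))"
      proof (rule sum_mono)
        fix z assume "z \<in> p - q"
        then obtain x k where z: "z = (x, k)" and xk: "(x, k) \<in> p" "(x, k) \<notin> q"
          by (cases z) auto
        note k = pk[OF xk(1)]
        have x: "x \<in> {a..b} - N" using xk k by (auto simp: q_def)
        have "Inf k \<in> k" "Sup k \<in> k" using k by (metis (no_types) atLeastAtMost_iff order_refl)+
        then have "Inf k \<in> ball x (r x)" "Sup k \<in> ball x (r x)"
          using k x by (auto simp: \<gamma>_def)
        moreover have "Inf k \<le> x" "x \<le> Sup k" using k by (metis atLeastAtMost_iff)+
        ultimately have "\<bar>(Sup k - Inf k) * f x - (F (Sup k) - F (Inf k))\<bar> \<le> \<eta> * (Sup k - Inf k)"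
          using k x by (intro r(2)) (auto simp: dist_real_def)
        then show "(case z of (x, k) \<Rightarrow> \<bar>measure lborel k *\<^sub>R g x - (F (Sup k) - F (Inf k))\<bar>)
            \<le> (case z of (x, k) \<Rightarrow> \<eta> * (Sup k - Inf k))"
          using k x by (simp add: z g_def)
      qed
      also have "\<dots> \<le> (\<Sum>(x, k)\<in>p. \<eta> * (Sup k - Inf k))"
        using fin \<eta>(1) pk by (intro sum_mono2) auto
      also have "\<dots> = \<eta> * (\<Sum>(x, k)\<in>p. Sup k - Inf k)"
        by (simp add: sum_distrib_left split_def)
      also have "\<dots> = \<eta> * (b - a)"
        using additive_tagged_division_1[OF ab p(1), of "\<lambda>x. x"] by simp
      finally have sp: "(\<Sum>(x, k)\<in>p - q. \<bar>measure lborel k *\<^sub>R g x - (F (Sup k) - F (Inf k))\<bar>) \<le> \<epsilon> / 2"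
        using \<eta>(2) by simp
      have "norm ((\<Sum>(x, k)\<in>p. measure lborel k *\<^sub>R g x) - (F b - F a))
          = \<bar>\<Sum>(x, k)\<in>p. measure lborel k *\<^sub>R g x - (F (Sup k) - F (Inf k))\<bar>"
        using additive_tagged_division_1[OF ab p(1), of F] by (simp add: split_def sum_subtractf)
      also have "\<dots> \<le> (\<Sum>(x, k)\<in>p. \<bar>measure lborel k *\<^sub>R g x - (F (Sup k) - F (Inf k))\<bar>)"
        by (simp add: split_def)
      also have "\<dots> = (\<Sum>(x, k)\<in>p - q. \<bar>measure lborel k *\<^sub>R g x - (F (Sup k) - F (Inf k))\<bar>)
          + (\<Sum>(x, k)\<in>q. \<bar>measure lborel k *\<^sub>R g x - (F (Sup k) - F (Inf k))\<bar>)"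
        by (rule sum.subset_diff[OF q fin])
      also have "\<dots> < \<epsilon>"
        using sp sq' by simp
      finally show ?thesis .
    qed
    ultimately show "\<exists>\<gamma>. gauge \<gamma> \<and> (\<forall>\<D>. \<D> tagged_division_of {a..b} \<and> \<gamma> fine \<D> \<longrightarrow>
        norm ((\<Sum>(x, k)\<in>\<D>. measure lborel k *\<^sub>R g x) - (F b - F a)) < \<epsilon>)"
      by (intro exI[of _ \<gamma>]) simp
  qed
  then show ?thesis
    by (rule has_integral_spike[OF N, rotated]) (simp add: g_def)
qed

section \<open>Solutions and Lagrange's identity\<close>

lemma ider_eqI:
  assumes "(u has_real_derivative D) (at t within I01)" "t \<in> I01"
  shows "ider u t = D"
  unfolding ider_def
  using assms by (intro vector_derivative_within_closed_interval)
    (auto simp: has_real_derivative_iff_has_vector_derivative)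

lemma ider_cong:
  assumes "\<And>x. x \<in> I01 \<Longrightarrow> u x = v x" "t \<in> I01"
  shows "ider u t = ider v t"
proof -
  have "(u has_vector_derivative D) (at t within I01) \<longleftrightarrow> (v has_vector_derivative D) (at t within I01)" for D
    using assms by (metis has_vector_derivative_transform)
  then show ?thesis by (simp add: ider_def vector_derivative_def)
qed

lemma W21_has_derivative:
  assumes "u \<in> W21" "t \<in> I01"
  shows "(u has_real_derivative ider u t) (at t within I01)"
proof -
  have "u differentiable (at t within I01)"
    using assms by (auto simp: W21_def differentiable_on_def)
  then obtain D where D: "(u has_real_derivative D) (at t within I01)"
    using real_differentiable_def by blast
  with ider_eqI[OF D assms(2)] show ?thesis by simp
qed

lemma W21_I:
  assumes "\<And>t. t \<in> I01 \<Longrightarrow> (u has_real_derivative u' t) (at t within I01)"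
    and "abs_continuous_on I01 u'"
  shows "u \<in> W21"
  unfolding W21_def
proof (intro CollectI conjI)
  show "u differentiable_on I01"
    unfolding differentiable_on_def real_differentiable_def using assms(1) by blast
  then show "continuous_on I01 u" by (rule differentiable_imp_continuous_on)
  show "abs_continuous_on I01 (ider u)"
    using assms(2) by (rule abs_continuous_on_cong) (simp add: assms(1) ider_eqI)
qed

lemma W21_continuous_on: "u \<in> W21 \<Longrightarrow> continuous_on I01 u"
  by (simp add: W21_def)

lemma W21_abs_continuous_on_ider: "u \<in> W21 \<Longrightarrow> abs_continuous_on I01 (ider u)"
  by (simp add: W21_def)

text \<open>The derivative is absolutely continuous, hence bounded, so the function itself is Lipschitz.\<close>

lemma W21_abs_continuous_on:
  assumes u: "u \<in> W21"
  shows "abs_continuous_on I01 u"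
proof -
  have "bounded (ider u ` I01)"
    by (intro compact_imp_bounded compact_continuous_image abs_continuous_on_imp_continuous_on
        W21_abs_continuous_on_ider[OF u] compact_Icc)
  then obtain M where M: "\<And>t. t \<in> I01 \<Longrightarrow> norm (ider u t) \<le> M"
    unfolding bounded_iff by (metis imageI)
  show ?thesis
  proof (rule lipschitz_imp_abs_continuous_on)
    fix x y assume "x \<in> I01" "y \<in> I01"
    then show "\<bar>u y - u x\<bar> \<le> M * \<bar>y - x\<bar>"
      using field_differentiable_bound[of I01 u "ider u" M y x] W21_has_derivative[OF u] M by simp
  qed
qed

lemma has_derivative_lincomb:
  assumes "(f has_real_derivative D) (at x within S)" "(g has_real_derivative E) (at x within S)"
  shows "((\<lambda>t. c * f t + d * g t) has_real_derivative c * D + d * E) (at x within S)"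
  by (intro DERIV_add DERIV_cmult assms)

lemma ider_lincomb:
  assumes "u \<in> W21" "v \<in> W21" "t \<in> I01"
  shows "ider (\<lambda>t. c * u t + d * v t) t = c * ider u t + d * ider v t"
  by (rule ider_eqI[OF has_derivative_lincomb]) (intro W21_has_derivative assms)+

lemma W21_lincomb:
  assumes "u \<in> W21" "v \<in> W21"
  shows "(\<lambda>t. c * u t + d * v t) \<in> W21"
proof (rule W21_I)
  show "((\<lambda>t. c * u t + d * v t) has_real_derivative c * ider u t + d * ider v t) (at t within I01)"
    if "t \<in> I01" for t
    using that assms by (intro has_derivative_lincomb W21_has_derivative)
  show "abs_continuous_on I01 (\<lambda>t. c * ider u t + d * ider v t)"
    using assms by (intro abs_continuous_on_lincomb W21_abs_continuous_on_ider)
qed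

lemma W21_cong:
  assumes u: "u \<in> W21" and eq: "\<And>t. t \<in> I01 \<Longrightarrow> v t = u t"
  shows "v \<in> W21"
proof (rule W21_I[where u' = "ider u"])
  show "(v has_real_derivative ider u t) (at t within I01)" if "t \<in> I01" for t
    using W21_has_derivative[OF u that] that eq
    by (auto intro: has_field_derivative_transform_within[where d = 1])
qed (rule W21_abs_continuous_on_ider[OF u])

text \<open>The form in which the equation is used: outside one null set, \<open>u''\<close> exists with its value solved for.\<close>

lemma solves_aeE:
  assumes "solves_ae a lam \<sigma> u"
  obtains N where "negligible N"
    "\<And>t. t \<in> I01 - N \<Longrightarrow> (ider u has_real_derivative \<sigma> t - (a t + lam) * u t) (at t within I01)"
proof -
  obtain N where N: "N \<in> null_sets lebesgue" and sub: "{t \<in> space lebesgue. \<not> (t \<in> I01 \<longrightarrow>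
        (\<exists>u2. (ider u has_real_derivative u2) (at t within I01) \<and>
              u2 + (a t + lam) * u t = \<sigma> t))} \<subseteq> N"
    using assms unfolding solves_ae_def eventually_ae_filter by blast
  show ?thesis
  proof (rule that[of N])
    show "negligible N" using N by (simp add: negligible_iff_null_sets)
    fix t assume "t \<in> I01 - N"
    with sub obtain u2 where u2: "(ider u has_real_derivative u2) (at t within I01)"
      "u2 + (a t + lam) * u t = \<sigma> t" by auto
    then have "u2 = \<sigma> t - (a t + lam) * u t" by simp
    with u2(1) show "(ider u has_real_derivative \<sigma> t - (a t + lam) * u t) (at t within I01)" by simp
  qed
qed

lemma solves_aeI:
  assumes N: "negligible N"
    and der: "\<And>t. t \<in> I01 - N \<Longrightarrow> (ider u has_real_derivative \<sigma> t - (a t + lam) * u t) (at t within I01)"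
  shows "solves_ae a lam \<sigma> u"
  unfolding solves_ae_def
proof (rule AE_I')
  show "N \<in> null_sets lebesgue" using N by (simp add: negligible_iff_null_sets)
  have "\<exists>u2. (ider u has_real_derivative u2) (at t within I01) \<and> u2 + (a t + lam) * u t = \<sigma> t"
    if "t \<in> I01 - N" for t
    using der[OF that] by (intro exI[of _ "\<sigma> t - (a t + lam) * u t"]) simp
  then show "{t \<in> space lebesgue. \<not> (t \<in> I01 \<longrightarrow>
        (\<exists>u2. (ider u has_real_derivative u2) (at t within I01) \<and>
              u2 + (a t + lam) * u t = \<sigma> t))} \<subseteq> N" by blast
qed

lemma solves_ae_lincomb:
  assumes uv: "u \<in> W21" "v \<in> W21" and su: "solves_ae a lam \<sigma> u" and sv: "solves_ae a lam \<tau> v"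
    and w: "\<And>t. t \<in> I01 \<Longrightarrow> w t = c * u t + d * v t"
    and \<rho>: "\<And>t. t \<in> I01 \<Longrightarrow> \<rho> t = c * \<sigma> t + d * \<tau> t"
  shows "solves_ae a lam \<rho> w"
proof -
  obtain N where N: "negligible N"
    "\<And>t. t \<in> I01 - N \<Longrightarrow> (ider u has_real_derivative \<sigma> t - (a t + lam) * u t) (at t within I01)"
    using solves_aeE[OF su] by blast
  obtain M where M: "negligible M"
    "\<And>t. t \<in> I01 - M \<Longrightarrow> (ider v has_real_derivative \<tau> t - (a t + lam) * v t) (at t within I01)"
    using solves_aeE[OF sv] by blast
  show ?thesis
  proof (rule solves_aeI[of "N \<union> M"])
    show "negligible (N \<union> M)" using N(1) M(1) by simp
    fix t assume t: "t \<in> I01 - (N \<union> M)"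
    have "ider w x = c * ider u x + d * ider v x" if "x \<in> I01" for x
      using ider_cong[of w "\<lambda>t. c * u t + d * v t" x] ider_lincomb[OF uv that] w that by simp
    moreover have "((\<lambda>t. c * ider u t + d * ider v t) has_real_derivative
        c * (\<sigma> t - (a t + lam) * u t) + d * (\<tau> t - (a t + lam) * v t)) (at t within I01)"
      using t by (intro has_derivative_lincomb N(2) M(2)) auto
    ultimately have "(ider w has_real_derivative
        c * (\<sigma> t - (a t + lam) * u t) + d * (\<tau> t - (a t + lam) * v t)) (at t within I01)"
      using t by (auto intro: has_field_derivative_transform_within[where d = 1])
    then show "(ider w has_real_derivative \<rho> t - (a t + lam) * w t) (at t within I01)"
      using t by (simp add: w \<rho> algebra_simps)
  qed
qed

text \<open>The coefficient \<open>a + \<lambda>\<close> cancels in \<open>(u' v - u v')' = u'' v - u v'' = \<sigma> v\<close>.  This holds almost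
  everywhere, and \<open>u' v - u v'\<close> is absolutely continuous, so the identity integrates.\<close>

theorem lagrange_identity:
  assumes uv: "u \<in> W21" "v \<in> W21" and su: "solves_ae a lam \<sigma> u" and sv: "solves_ae a lam (\<lambda>_. 0) v"
    and xy: "0 \<le> x" "x \<le> y" "y \<le> 1"
  shows "((\<lambda>s. \<sigma> s * v s) has_integral
      (ider u y * v y - u y * ider v y) - (ider u x * v x - u x * ider v x)) {x..y}"
proof -
  obtain N where N: "negligible N"
    "\<And>t. t \<in> I01 - N \<Longrightarrow> (ider u has_real_derivative \<sigma> t - (a t + lam) * u t) (at t within I01)"
    using solves_aeE[OF su] by blast
  obtain M where M: "negligible M"
    "\<And>t. t \<in> I01 - M \<Longrightarrow> (ider v has_real_derivative 0 - (a t + lam) * v t) (at t within I01)"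
    using solves_aeE[OF sv] by blast
  have sub: "{x..y} \<subseteq> I01" using xy by auto
  define F where "F t = ider u t * v t - u t * ider v t" for t
  have "abs_continuous_on I01 (\<lambda>t. 1 * (ider u t * v t) + (-1) * (u t * ider v t))"
    using uv by (intro abs_continuous_on_lincomb abs_continuous_on_mult W21_abs_continuous_on
        W21_abs_continuous_on_ider)
  then have "abs_continuous_on {x..y} F"
    by (rule abs_continuous_on_subset[THEN abs_continuous_on_cong, OF _ sub]) (simp add: F_def)
  then have "((\<lambda>s. \<sigma> s * v s) has_integral (F y - F x)) {x..y}"
  proof (rule fundamental_theorem_of_calculus_abs_continuous[rotated 2])
    show "negligible (N \<union> M)" using N(1) M(1) by simp
    fix t assume t: "t \<in> {x..y} - (N \<union> M)"
    then have t': "t \<in> I01" "t \<in> I01 - N" "t \<in> I01 - M" using sub by auto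
    note [derivative_intros] = W21_has_derivative[OF uv(1) t'(1)] W21_has_derivative[OF uv(2) t'(1)]
      N(2)[OF t'(2)] M(2)[OF t'(3)]
    have "(F has_real_derivative \<sigma> t * v t) (at t within I01)"
      unfolding F_def
      by (auto intro!: derivative_eq_intros simp: algebra_simps)
    then show "(F has_real_derivative \<sigma> t * v t) (at t within {x..y})"
      by (rule has_field_derivative_subset[OF _ sub])
  qed (fact xy)
  then show ?thesis by (simp add: F_def)
qed

lemma absolutely_integrable_continuous_mult:
  fixes k \<sigma> :: "real \<Rightarrow> real"
  assumes "continuous_on {x..y} k" "\<sigma> absolutely_integrable_on {x..y}"
  shows "(\<lambda>s. k s * \<sigma> s) absolutely_integrable_on {x..y}"
proof (rule absolutely_integrable_bounded_measurable_product_real)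
  show "k \<in> borel_measurable (lebesgue_on {x..y})"
    using assms(1) by (rule continuous_imp_measurable_on_sets_lebesgue) simp
  show "bounded (k ` {x..y})"
    using assms(1) by (intro compact_imp_bounded compact_continuous_image compact_Icc)
qed (use assms(2) in simp_all)

text \<open>A contraction argument.  Let \<open>m\<close> be the maximum of \<open>\<bar>u\<bar>\<close> on the interval and \<open>K < 1\<close> the integral
  of \<open>\<bar>a + \<lambda>\<bar>\<close>.  Integrating the equation gives \<open>\<bar>u'\<bar> \<le> m K\<close>, and since the interval has length at
  most 1 the mean value inequality gives \<open>m \<le> m K\<close>, hence \<open>m = 0\<close>.\<close>

lemma zero_data_short_interval:
  assumes u: "u \<in> W21" "solves_ae a lam (\<lambda>_. 0) u" and a: "a absolutely_integrable_on I01"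
    and xy: "0 \<le> x" "x \<le> y" "y \<le> 1" and zero: "u x = 0" "ider u x = 0"
    and small: "integral {x..y} (\<lambda>t. \<bar>a t + lam\<bar>) < 1"
    and t: "t \<in> {x..y}"
  shows "u t = 0 \<and> ider u t = 0"
proof -
  let ?K = "integral {x..y} (\<lambda>t. \<bar>a t + lam\<bar>)"
  have sub: "{x..y} \<subseteq> I01" using xy by auto
  have "(\<lambda>t. a t + lam) absolutely_integrable_on I01"
    using a absolutely_integrable_continuous_real[of 0 1 "\<lambda>_. lam"] by (intro set_integral_add) auto
  then have "(\<lambda>t. a t + lam) absolutely_integrable_on {x..y}"
    using sub by (auto intro: set_integrable_subset)
  then have q: "(\<lambda>t. \<bar>a t + lam\<bar>) integrable_on {x..y}"
    by (simp add: absolutely_integrable_on_def)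
  obtain N where N: "negligible N"
    "\<And>t. t \<in> I01 - N \<Longrightarrow> (ider u has_real_derivative 0 - (a t + lam) * u t) (at t within I01)"
    using solves_aeE[OF u(2)] by blast
  have "continuous_on {x..y} (\<lambda>t. \<bar>u t\<bar>)"
    using W21_continuous_on[OF u(1)] sub by (auto intro!: continuous_intros intro: continuous_on_subset)
  then obtain t0 where t0: "t0 \<in> {x..y}" "\<And>t. t \<in> {x..y} \<Longrightarrow> \<bar>u t\<bar> \<le> \<bar>u t0\<bar>"
    using continuous_attains_sup[of "{x..y}" "\<lambda>t. \<bar>u t\<bar>"] xy by auto
  let ?m = "\<bar>u t0\<bar>"
  have der: "\<bar>ider u s\<bar> \<le> ?m * ?K" if s: "s \<in> {x..y}" for s
  proof -
    have sub': "{x..s} \<subseteq> I01" using s sub by auto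
    have q': "(\<lambda>t. \<bar>a t + lam\<bar>) integrable_on {x..s}"
      using q s by (auto intro: integrable_on_subinterval)
    have I: "((\<lambda>t. 0 - (a t + lam) * u t) has_integral (ider u s - ider u x)) {x..s}"
    proof (rule fundamental_theorem_of_calculus_abs_continuous[OF _ N(1)])
      show "abs_continuous_on {x..s} (ider u)"
        using W21_abs_continuous_on_ider[OF u(1)] sub' by (rule abs_continuous_on_subset)
      fix t assume "t \<in> {x..s} - N"
      then show "(ider u has_real_derivative 0 - (a t + lam) * u t) (at t within {x..s})"
        using sub' by (intro has_field_derivative_subset[OF N(2)]) auto
    qed (use s in simp)
    have "norm (integral {x..s} (\<lambda>t. 0 - (a t + lam) * u t)) \<le> integral {x..s} (\<lambda>t. ?m * \<bar>a t + lam\<bar>)"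
    proof (rule integral_norm_bound_integral)
      show "(\<lambda>t. 0 - (a t + lam) * u t) integrable_on {x..s}" using I by blast
      show "(\<lambda>t. ?m * \<bar>a t + lam\<bar>) integrable_on {x..s}"
        using q' by (rule integrable_on_mult_right)
      show "norm (0 - (a t + lam) * u t) \<le> ?m * \<bar>a t + lam\<bar>" if "t \<in> {x..s}" for t
        using t0(2)[of t] that s by (simp add: abs_mult mult.commute mult_right_mono)
    qed
    also have "\<dots> = ?m * integral {x..s} (\<lambda>t. \<bar>a t + lam\<bar>)" by simp
    also have "\<dots> \<le> ?m * ?K"
      using s q q' by (intro mult_left_mono integral_subset_le) auto
    finally show ?thesis using integral_unique[OF I] zero(2) by simp
  qed
  have K: "?K \<ge> 0" by (simp add: integral_nonneg q)
  have "norm (u t0 - u x) \<le> (?m * ?K) * norm (t0 - x)"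
  proof (rule field_differentiable_bound[of "{x..y}" u "ider u"])
    show "(u has_real_derivative ider u z) (at z within {x..y})" if "z \<in> {x..y}" for z
      using W21_has_derivative[OF u(1), of z] that sub has_field_derivative_subset by blast
  qed (use der t0 xy in auto)
  also have "\<dots> \<le> (?m * ?K) * 1"
    using t0(1) xy K by (intro mult_left_mono) auto
  finally have "?m \<le> ?m * ?K" using zero(1) by simp
  then have m: "?m = 0"
    using small mult_less_cancel_left2[of ?m ?K] by linarith
  then show ?thesis using t0(2)[OF t] der[OF t] by simp
qed

text \<open>Uniform continuity of the indefinite integral of \<open>\<bar>a + \<lambda>\<bar>\<close> provides one step length for which the
  short-interval argument applies everywhere, so that finitely many steps cover \<open>[0,1]\<close>.\<close>

lemma zero_initial_data_imp_zero:
  assumes u: "u \<in> W21" "solves_ae a lam (\<lambda>_. 0) u" and a: "a absolutely_integrable_on I01"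
    and zero: "u 0 = 0" "ider u 0 = 0" and t: "t \<in> I01"
  shows "u t = 0"
proof -
  let ?q = "\<lambda>t. \<bar>a t + lam\<bar>"
  have "(\<lambda>t. a t + lam) absolutely_integrable_on I01"
    using a absolutely_integrable_continuous_real[of 0 1 "\<lambda>_. lam"] by (intro set_integral_add) auto
  then have q: "?q integrable_on I01"
    by (simp add: absolutely_integrable_on_def)
  have "uniformly_continuous_on I01 (\<lambda>t. integral {0..t} ?q)"
    by (intro compact_uniformly_continuous indefinite_integral_continuous_1 q) simp
  then obtain h where h: "h > 0" "\<And>x y. \<lbrakk>x \<in> I01; y \<in> I01; dist y x < h\<rbrakk> \<Longrightarrow>
      dist (integral {0..y} ?q) (integral {0..x} ?q) < 1"
    unfolding uniformly_continuous_on_def by (metis zero_less_one)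
  \<comment> \<open>Steps of half the modulus \<open>h\<close>, because the modulus needs a strict inequality.\<close>
  have "\<forall>t\<in>I01. t \<le> real k * (h/2) \<longrightarrow> u t = 0 \<and> ider u t = 0" for k
  proof (induction k)
    case 0
    then show ?case using zero by auto
  next
    case (Suc k)
    show ?case
    proof (intro ballI impI)
      fix t assume t: "t \<in> I01" "t \<le> real (Suc k) * (h/2)"
      define x where "x = real k * (h/2)"
      show "u t = 0 \<and> ider u t = 0"
      proof (cases "t \<le> x")
        case True
        then show ?thesis using Suc.IH t by (simp add: x_def)
      next
        case False
        have x: "x \<in> I01" "x \<le> t" using False t(1) h(1) by (auto simp: x_def)
        have "t - x \<le> h/2" using t(2) by (simp add: x_def field_simps)
        then have "dist t x < h" using x(2) h(1) by (simp add: dist_real_def)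
        from h(2)[OF x(1) t(1) this]
        have "integral {0..t} ?q - integral {0..x} ?q < 1" by (simp add: dist_real_def)
        moreover have "integral {0..x} ?q + integral {x..t} ?q = integral {0..t} ?q"
          using x t(1) q
          by (intro Henstock_Kurzweil_Integration.integral_combine) (auto intro: integrable_on_subinterval)
        ultimately have small: "integral {x..t} ?q < 1" by simp
        have "u x = 0" "ider u x = 0" using Suc.IH x(1) by (auto simp: x_def)
        then show ?thesis
          using x t by (intro zero_data_short_interval[OF u a _ _ _ _ _ small]) auto
      qed
    qed
  qed
  moreover obtain k where "1 / (h/2) < real k" using reals_Archimedean2 by blast
  then have "1 \<le> real k * (h/2)" using h(1) by (simp add: field_simps)
  ultimately show ?thesis using t by (meson atLeastAtMost_iff order_trans)
qed

section \<open>Continuous kernels and Green's functions\<close>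

lemma set_lebesgue_integral_eqI:
  fixes f :: "real \<Rightarrow> real"
  assumes "f absolutely_integrable_on S" "(f has_integral c) S"
  shows "(LINT s:S|lebesgue. f s) = c"
  using set_lebesgue_integral_eq_integral(2)[OF assms(1)] assms(2) by (simp add: integral_unique)

text \<open>Test the two kernels against their own difference: the integral of its square vanishes.\<close>

lemma continuous_kernel_unique:
  fixes k l :: "real \<Rightarrow> real"
  assumes k: "continuous_on I01 k" and l: "continuous_on I01 l"
    and eq: "\<And>\<sigma>. \<sigma> absolutely_integrable_on I01 \<Longrightarrow>
      (LINT s:I01|lebesgue. k s * \<sigma> s) = (LINT s:I01|lebesgue. l s * \<sigma> s)"
    and s: "s \<in> I01"
  shows "k s = l s"
proof -
  define \<delta> where "\<delta> s = k s - l s" for s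
  have \<delta>: "continuous_on I01 \<delta>"
    unfolding \<delta>_def using k l by (intro continuous_intros)
  then have int: "\<delta> absolutely_integrable_on I01" by (rule absolutely_integrable_continuous_real)
  have "(LINT s:I01|lebesgue. k s * \<delta> s - l s * \<delta> s)
      = (LINT s:I01|lebesgue. k s * \<delta> s) - (LINT s:I01|lebesgue. l s * \<delta> s)"
    using k l int by (intro set_integral_diff absolutely_integrable_continuous_mult)
  also have "\<dots> = 0" using eq[OF int] by simp
  finally have "(LINT s:I01|lebesgue. \<delta> s * \<delta> s) = 0"
    by (simp add: \<delta>_def left_diff_distrib)
  moreover have "(\<lambda>s. \<delta> s * \<delta> s) absolutely_integrable_on I01"
    using \<delta> int by (rule absolutely_integrable_continuous_mult)
  ultimately have "integral I01 (\<lambda>s. \<delta> s * \<delta> s) = 0"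
    by (simp add: set_lebesgue_integral_eq_integral(2))
  then have "\<forall>s\<in>I01. \<delta> s * \<delta> s = 0"
    using integral_eq_0_iff[OF continuous_on_mult[OF \<delta> \<delta>]] by simp
  then have "\<delta> s * \<delta> s = 0" using s by (rule bspec)
  then show ?thesis by (simp add: \<delta>_def)
qed

lemma continuous_on_section:
  assumes "continuous_on (I01 \<times> I01) (\<lambda>(t, s). G t s)" "t \<in> I01"
  shows "continuous_on I01 (G t)"
proof -
  have "continuous_on I01 ((\<lambda>(t, s). G t s) \<circ> (\<lambda>s. (t, s)))"
    using assms by (intro continuous_on_compose continuous_intros) (auto intro: continuous_on_subset)
  then show ?thesis by (simp add: o_def)
qed

lemma is_greens_functionD:
  assumes "is_greens_function X a lam G" "\<sigma> absolutely_integrable_on I01"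
  shows "(\<lambda>t. LINT s:I01|lebesgue. G t s * \<sigma> s) \<in> X"
    "solves_ae a lam \<sigma> (\<lambda>t. LINT s:I01|lebesgue. G t s * \<sigma> s)"
    "\<And>u t. \<lbrakk>u \<in> X; solves_ae a lam \<sigma> u; t \<in> I01\<rbrakk> \<Longrightarrow> u t = (LINT s:I01|lebesgue. G t s * \<sigma> s)"
  using assms by (simp_all add: is_greens_function_def)

lemma cont_ext_eq:
  assumes h: "continuous_on I01 h" and f: "\<And>x. x \<in> {0<..<1} \<Longrightarrow> f x = h x" and x: "x \<in> I01"
  shows "cont_ext f x = h x"
proof (cases "x \<in> {0<..<1}")
  case True
  then show ?thesis using f by (simp add: cont_ext_def)
next
  case False
  have "(h \<longlongrightarrow> h x) (at x within I01)"
    using h x by (simp add: continuous_on_def)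
  then have "(h \<longlongrightarrow> h x) (at x within {0<..<1})"
    by (rule tendsto_within_subset) auto
  then have "(f \<longlongrightarrow> h x) (at x within {0<..<1})"
    by (rule Lim_transform_within[where d = 1]) (auto simp: f)
  moreover have "\<not> trivial_limit (at x within {0<..<1})"
  proof -
    have "x = 0 \<or> x = 1" using x False by auto
    then show ?thesis
      using islimpt_greaterThanLessThan1[of 0 "1::real"] islimpt_greaterThanLessThan2[of 0 "1::real"]
      by (auto simp: trivial_limit_within)
  qed
  ultimately have "Lim (at x within {0<..<1}) f = h x" by (intro tendsto_Lim)
  with False show ?thesis by (auto simp: cont_ext_def)
qed


section \<open>The Dirichlet kernel and the periodic kernel\<close>

text \<open>The homogeneous solutions \<open>r1\<close> and \<open>r2\<close> form the basis adapted to the two endpoints.\<close>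

locale dirichlet_basis =
  fixes a r1 r2 :: "real \<Rightarrow> real" and lam :: real
  assumes a: "a absolutely_integrable_on I01"
    and r1: "r1 \<in> W21" "solves_ae a lam (\<lambda>_. 0) r1" "r1 0 = 1" "r1 1 = 0"
    and r2: "r2 \<in> W21" "solves_ae a lam (\<lambda>_. 0) r2" "r2 0 = 0" "r2 1 = 1"
begin

text \<open>The Wronskian \<open>r1 r2' - r1' r2\<close>, which is constant, evaluated at 0.\<close>

definition W :: real where "W = ider r2 0"

definition dirichlet_kernel :: "real \<Rightarrow> real \<Rightarrow> real" where
  "dirichlet_kernel t s = - (r1 (max t s) * r2 (min t s)) / W"

definition w :: "real \<Rightarrow> real" where "w t = r1 t + r2 t"

text \<open>Lagrange's identity for \<open>r2\<close> and \<open>r1\<close> integrates the zero function, so its boundary expression is constant.\<close>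

lemma wronskian:
  assumes t: "t \<in> I01"
  shows "r1 t * ider r2 t - ider r1 t * r2 t = W"
proof -
  have "((\<lambda>s. 0 * r1 s) has_integral
      (ider r2 t * r1 t - r2 t * ider r1 t) - (ider r2 0 * r1 0 - r2 0 * ider r1 0)) {0..t}"
    using t by (intro lagrange_identity[OF r2(1) r1(1) r2(2) r1(2)]) auto
  then have "ider r2 t * r1 t - r2 t * ider r1 t = ider r2 0 * r1 0 - r2 0 * ider r1 0"
    by (simp add: has_integral_0_eq)
  then show ?thesis using r1 r2 by (simp add: W_def mult.commute)
qed

lemma ider_r1_1: "ider r1 1 = - W"
  using wronskian[of 1] r1 r2 by simp

text \<open>Otherwise \<open>r2\<close> would vanish together with its derivative at 0, contradicting \<open>r2 1 = 1\<close>.\<close>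

lemma W_nonzero: "W \<noteq> 0"
proof
  assume "W = 0"
  then have "r2 1 = 0"
    using zero_initial_data_imp_zero[OF r2(1,2) a r2(3)] by (simp add: W_def)
  then show False using r2 by simp
qed

lemma dirichlet_kernel_commute: "dirichlet_kernel s t = dirichlet_kernel t s"
  by (simp add: dirichlet_kernel_def max.commute min.commute)

lemma continuous_on_dirichlet_kernel:
  assumes t: "t \<in> I01"
  shows "continuous_on I01 (dirichlet_kernel t)"
proof -
  have "continuous_on I01 (\<lambda>s. r1 (max t s))"
    by (rule continuous_on_compose2[OF W21_continuous_on[OF r1(1)]])
      (use t in \<open>auto intro!: continuous_on_max continuous_on_const continuous_on_id\<close>)
  moreover have "continuous_on I01 (\<lambda>s. r2 (min t s))"
    by (rule continuous_on_compose2[OF W21_continuous_on[OF r2(1)]])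
      (use t in \<open>auto intro!: continuous_on_min continuous_on_const continuous_on_id\<close>)
  ultimately have "continuous_on I01 (\<lambda>s. - (r1 (max t s) * r2 (min t s)) / W)"
    by (intro continuous_on_divide continuous_on_minus continuous_on_mult continuous_on_const)
      (simp_all add: W_nonzero)
  then show ?thesis by (simp add: dirichlet_kernel_def[abs_def])
qed

text \<open>Because \<open>u\<close> and \<open>r2\<close> vanish at 0, the integral of \<open>\<sigma> r2\<close> over \<open>[0,t]\<close> is \<open>(u' r2 - u r2')(t)\<close>;
  because \<open>u\<close> and \<open>r1\<close> vanish at 1, that of \<open>\<sigma> r1\<close> over \<open>[t,1]\<close> is \<open>- (u' r1 - u r1')(t)\<close>.  With weights
  \<open>- r1(t) / W\<close> and \<open>- r2(t) / W\<close> the terms in \<open>u'(t)\<close> cancel and the rest is \<open>u(t)\<close> times the Wronskian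
  over \<open>W\<close>.\<close>

lemma dirichlet_representation:
  assumes u: "u \<in> X_D" "solves_ae a lam \<sigma> u" and t: "t \<in> I01"
  shows "((\<lambda>s. dirichlet_kernel t s * \<sigma> s) has_integral u t) I01"
proof -
  have uW: "u \<in> W21" "u 0 = 0" "u 1 = 0" using u by (auto simp: X_D_def)
  have "((\<lambda>s. \<sigma> s * r2 s) has_integral
      (ider u t * r2 t - u t * ider r2 t) - (ider u 0 * r2 0 - u 0 * ider r2 0)) {0..t}"
    using t by (intro lagrange_identity[OF uW(1) r2(1) u(2) r2(2)]) auto
  then have "((\<lambda>s. \<sigma> s * r2 s) has_integral (ider u t * r2 t - u t * ider r2 t)) {0..t}"
    using uW r2 by simp
  from has_integral_mult_right[OF this, of "- r1 t / W"]
  have left: "((\<lambda>s. dirichlet_kernel t s * \<sigma> s) has_integral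
      - r1 t / W * (ider u t * r2 t - u t * ider r2 t)) {0..t}"
    by (rule has_integral_eq[rotated]) (auto simp: dirichlet_kernel_def max_def min_def)
  have "((\<lambda>s. \<sigma> s * r1 s) has_integral
      (ider u 1 * r1 1 - u 1 * ider r1 1) - (ider u t * r1 t - u t * ider r1 t)) {t..1}"
    using t by (intro lagrange_identity[OF uW(1) r1(1) u(2) r1(2)]) auto
  then have "((\<lambda>s. \<sigma> s * r1 s) has_integral (- (ider u t * r1 t - u t * ider r1 t))) {t..1}"
    using uW r1 by simp
  from has_integral_mult_right[OF this, of "- r2 t / W"]
  have right: "((\<lambda>s. dirichlet_kernel t s * \<sigma> s) has_integral
      - r2 t / W * (- (ider u t * r1 t - u t * ider r1 t))) {t..1}"
    by (rule has_integral_eq[rotated]) (auto simp: dirichlet_kernel_def max_def min_def)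
  have "- r1 t / W * (ider u t * r2 t - u t * ider r2 t)
      + - r2 t / W * (- (ider u t * r1 t - u t * ider r1 t))
      = u t * (r1 t * ider r2 t - ider r1 t * r2 t) / W"
    using W_nonzero by (simp add: field_simps)
  also have "\<dots> = u t" using wronskian[OF t] W_nonzero by simp
  finally show ?thesis
    using has_integral_combine[OF _ _ left right] t by simp
qed

lemma dirichlet_greens_function_eq:
  assumes G: "is_greens_function X_D a lam G" and ts: "t \<in> I01" "s \<in> I01"
  shows "G t s = dirichlet_kernel t s"
proof (rule continuous_kernel_unique[OF _ continuous_on_dirichlet_kernel[OF ts(1)] _ ts(2)])
  show "continuous_on I01 (G t)"
    using G by (auto simp: is_greens_function_def intro: continuous_on_section ts(1))
  fix \<sigma> :: "real \<Rightarrow> real" assume \<sigma>: "\<sigma> absolutely_integrable_on I01"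
  show "(LINT s:I01|lebesgue. G t s * \<sigma> s) = (LINT s:I01|lebesgue. dirichlet_kernel t s * \<sigma> s)"
    using dirichlet_representation[OF is_greens_functionD(1,2)[OF G \<sigma>] ts(1)]
    by (intro set_lebesgue_integral_eqI[symmetric] absolutely_integrable_continuous_mult
        continuous_on_dirichlet_kernel ts(1) \<sigma>)
qed

text \<open>For \<open>s\<close> inside \<open>(0,1)\<close> the kernel is a multiple of \<open>r2\<close> as a function of \<open>t \<le> s\<close> and a multiple of
  \<open>r1\<close> for \<open>t \<ge> s\<close>, so its end slopes are multiples of \<open>r2'(0) = W\<close> and \<open>r1'(1) = - W\<close>, which cancel the
  denominator.\<close>

lemma bdry_deriv_t_eq:
  assumes G: "\<forall>t\<in>I01. \<forall>s\<in>I01. G t s = dirichlet_kernel t s" and s: "s \<in> I01"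
  shows "bdry_deriv_t G 0 s = - r1 s" "bdry_deriv_t G 1 s = r2 s"
proof -
  have "ider (\<lambda>t. G t s) 0 = - r1 s" if s: "s \<in> {0<..<1}" for s
  proof (rule ider_eqI)
    have "((\<lambda>t. - r1 s / W * r2 t) has_real_derivative - r1 s / W * W) (at 0 within I01)"
      using W21_has_derivative[OF r2(1), of 0] by (auto intro!: derivative_eq_intros simp: W_def)
    then have "((\<lambda>t. - r1 s / W * r2 t) has_real_derivative - r1 s) (at 0 within I01)"
      using W_nonzero by simp
    then show "((\<lambda>t. G t s) has_real_derivative - r1 s) (at 0 within I01)"
      by (rule has_field_derivative_transform_within[where d = s])
        (use s in \<open>auto simp: G dirichlet_kernel_def dist_real_def\<close>)
  qed simp
  then show "bdry_deriv_t G 0 s = - r1 s"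
    unfolding bdry_deriv_t_def using s
    by (intro cont_ext_eq[where h = "\<lambda>s. - r1 s"] continuous_intros W21_continuous_on r1(1))
  have "ider (\<lambda>t. G t s) 1 = r2 s" if s: "s \<in> {0<..<1}" for s
  proof (rule ider_eqI)
    have "((\<lambda>t. - r2 s / W * r1 t) has_real_derivative - r2 s / W * (- W)) (at 1 within I01)"
      using W21_has_derivative[OF r1(1), of 1]
      by (auto intro!: derivative_eq_intros simp: ider_r1_1)
    then have "((\<lambda>t. - r2 s / W * r1 t) has_real_derivative r2 s) (at 1 within I01)"
      using W_nonzero by simp
    then show "((\<lambda>t. G t s) has_real_derivative r2 s) (at 1 within I01)"
      by (rule has_field_derivative_transform_within[where d = "1 - s"])
        (use s in \<open>auto simp: G dirichlet_kernel_def dist_real_def max_def min_def\<close>)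
  qed simp
  then show "bdry_deriv_t G 1 s = r2 s"
    unfolding bdry_deriv_t_def using s
    by (intro cont_ext_eq W21_continuous_on r2(1))
qed

text \<open>The kernel is symmetric, so this is the preceding lemma with the variables exchanged.\<close>

lemma bdry_deriv_s_eq:
  assumes G: "\<forall>t\<in>I01. \<forall>s\<in>I01. G t s = dirichlet_kernel t s" and t: "t \<in> I01"
  shows "bdry_deriv_s G t 0 = - r1 t" "bdry_deriv_s G t 1 = r2 t"
proof -
  have "\<forall>s\<in>I01. \<forall>t\<in>I01. G t s = dirichlet_kernel s t"
    using G by (simp add: dirichlet_kernel_commute)
  from bdry_deriv_t_eq[OF this t]
  show "bdry_deriv_s G t 0 = - r1 t" "bdry_deriv_s G t 1 = r2 t"
    by (simp_all add: bdry_deriv_s_def bdry_deriv_t_def)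
qed

lemma w_W21: "w \<in> W21"
  using W21_lincomb[OF r1(1) r2(1), of 1 1] by (simp add: w_def[abs_def])

lemma w_solves: "solves_ae a lam (\<lambda>_. 0) w"
  by (rule solves_ae_lincomb[OF r1(1) r2(1) r1(2) r2(2), of w 1 1]) (simp_all add: w_def)

lemma w_endpoints: "w 0 = 1" "w 1 = 1"
  using r1 r2 by (simp_all add: w_def)

text \<open>This is the quantity \<open>\<Delta>\<close> of the theorem: in \<open>r1'(1) + r2'(1) - r1'(0) - r2'(0)\<close> the last term is
  \<open>- W = r1'(1)\<close>, whence the factor 2.\<close>

lemma w_slope_jump: "ider w 1 - ider w 0 = 2 * ider r1 1 + ider r2 1 - ider r1 0"
  using ider_lincomb[OF r1(1) r2(1), of 1 1 1] ider_lincomb[OF r1(1) r2(1), of 0 1 1] ider_r1_1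
  by (simp add: w_def[abs_def] W_def)

text \<open>Lagrange's identity for \<open>u\<close> and \<open>w\<close> over the whole interval; only slopes of \<open>u\<close> survive at the ends.\<close>

lemma dirichlet_slope_jump:
  assumes u: "u \<in> X_D" "solves_ae a lam \<sigma> u"
  shows "((\<lambda>s. w s * \<sigma> s) has_integral (ider u 1 - ider u 0)) I01"
  using lagrange_identity[OF _ w_W21 u(2) w_solves, of 0 1] u(1) w_endpoints
  by (simp add: X_D_def mult.commute)

text \<open>Existence: subtract from the Dirichlet solution the multiple of \<open>w\<close> that equalises the end slopes.
  Uniqueness: a homogeneous periodic \<open>y\<close> satisfies \<open>y = y(0) w\<close>, since \<open>y - y(0) w\<close> vanishes at both
  ends and the Dirichlet problem is nonresonant; equality of the end slopes then reads
  \<open>y(0) \<Delta> = 0\<close>.\<close>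

lemma periodic_greens_function:
  assumes nonres: "nonresonant X_D a lam" and G: "is_greens_function X_D a lam G"
    and \<Delta>: "\<Delta> = ider w 1 - ider w 0" "\<Delta> \<noteq> 0"
  shows "is_greens_function X_P a lam (\<lambda>t s. G t s - w t * w s / \<Delta>)"
  unfolding is_greens_function_def
proof (intro conjI allI impI)
  have cG: "continuous_on (I01 \<times> I01) (\<lambda>(t, s). G t s)"
    using G by (simp add: is_greens_function_def)
  have cw: "continuous_on I01 w" using w_W21 by (rule W21_continuous_on)
  have "continuous_on (I01 \<times> I01) (\<lambda>p. w (fst p))" "continuous_on (I01 \<times> I01) (\<lambda>p. w (snd p))"
    by (auto intro!: continuous_on_compose2[OF cw] continuous_intros)
  then have "continuous_on (I01 \<times> I01) (\<lambda>p. (\<lambda>(t, s). G t s) p - w (fst p) * w (snd p) / \<Delta>)"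
    using cG \<Delta>(2) by (intro continuous_intros) auto
  then show "continuous_on (I01 \<times> I01) (\<lambda>(t, s). G t s - w t * w s / \<Delta>)"
    by (simp add: split_def)
  fix \<sigma> :: "real \<Rightarrow> real" assume \<sigma>: "\<sigma> absolutely_integrable_on I01"
  define u where "u t = (LINT s:I01|lebesgue. G t s * \<sigma> s)" for t
  have u: "u \<in> X_D" "solves_ae a lam \<sigma> u"
    using is_greens_functionD(1,2)[OF G \<sigma>] by (simp_all add: u_def[abs_def])
  have uW: "u \<in> W21" "u 0 = 0" "u 1 = 0" using u(1) by (auto simp: X_D_def)
  define c where "c = (ider u 1 - ider u 0) / \<Delta>"
  define v where "v t = (LINT s:I01|lebesgue. (G t s - w t * w s / \<Delta>) * \<sigma> s)" for t
  \<comment> \<open>The factor 1 puts \<open>u - c w\<close> in the shape of the lemmas on linear combinations.\<close>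
  have v: "v t = 1 * u t + (- c) * w t" if t: "t \<in> I01" for t
  proof -
    have iG: "(\<lambda>s. G t s * \<sigma> s) absolutely_integrable_on I01"
      using continuous_on_section[OF cG t] \<sigma> by (rule absolutely_integrable_continuous_mult)
    have iw: "(\<lambda>s. w s * \<sigma> s) absolutely_integrable_on I01"
      using cw \<sigma> by (rule absolutely_integrable_continuous_mult)
    have "v t = (LINT s:I01|lebesgue. G t s * \<sigma> s - w t / \<Delta> * (w s * \<sigma> s))"
      by (simp add: v_def left_diff_distrib mult.assoc)
    also have "\<dots> = (LINT s:I01|lebesgue. G t s * \<sigma> s) - (LINT s:I01|lebesgue. w t / \<Delta> * (w s * \<sigma> s))"
      using iG iw by (intro set_integral_diff) auto
    also have "(LINT s:I01|lebesgue. w t / \<Delta> * (w s * \<sigma> s)) = w t / \<Delta> * (ider u 1 - ider u 0)"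
      using set_lebesgue_integral_eqI[OF iw dirichlet_slope_jump[OF u]] by simp
    finally show ?thesis by (simp add: u_def c_def)
  qed
  have vW: "v \<in> W21"
    using W21_cong[OF W21_lincomb[OF uW(1) w_W21, of 1 "- c"] v] .
  have ider_v: "ider v t = ider u t - c * ider w t" if "t \<in> I01" for t
    using ider_cong[OF v that] ider_lincomb[OF uW(1) w_W21 that, of 1 "- c"] by simp
  have jump: "ider v 1 - ider v 0 = 0"
  proof -
    have "ider v 1 - ider v 0 = (ider u 1 - ider u 0) - c * (ider w 1 - ider w 0)"
      by (simp add: ider_v algebra_simps)
    then show ?thesis using \<Delta> by (simp add: c_def)
  qed
  have vP: "v \<in> X_P"
    using vW jump v[of 0] v[of 1] uW w_endpoints by (simp add: X_P_def)
  then show "(\<lambda>t. LINT s:I01|lebesgue. (G t s - w t * w s / \<Delta>) * \<sigma> s) \<in> X_P"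
    by (simp add: v_def[abs_def])
  have sv: "solves_ae a lam \<sigma> v"
    by (rule solves_ae_lincomb[OF uW(1) w_W21 u(2) w_solves v]) simp_all
  then show "solves_ae a lam \<sigma> (\<lambda>t. LINT s:I01|lebesgue. (G t s - w t * w s / \<Delta>) * \<sigma> s)"
    by (simp add: v_def[abs_def])
  show "\<forall>x\<in>X_P. solves_ae a lam \<sigma> x \<longrightarrow>
      (\<forall>t\<in>I01. x t = (LINT s:I01|lebesgue. (G t s - w t * w s / \<Delta>) * \<sigma> s))"
  proof (intro ballI impI)
    fix x t assume x: "x \<in> X_P" "solves_ae a lam \<sigma> x" and t: "t \<in> I01"
    have xW: "x \<in> W21" using x(1) by (simp add: X_P_def)
    define y where "y t = 1 * x t + (-1) * v t" for t
    have yW: "y \<in> W21" unfolding y_def[abs_def] by (rule W21_lincomb[OF xW vW])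
    have sy: "solves_ae a lam (\<lambda>_. 0) y"
      by (rule solves_ae_lincomb[OF xW vW x(2) sv, of y 1 "-1"]) (simp_all add: y_def)
    have ider_y: "ider y t = ider x t - ider v t" if "t \<in> I01" for t
      using ider_lincomb[OF xW vW that, of 1 "-1"] by (simp add: y_def[abs_def])
    have yper: "y 0 = y 1" "ider y 0 = ider y 1"
      using x(1) vP by (simp_all add: y_def ider_y X_P_def)
    define z where "z t = 1 * y t + (- y 0) * w t" for t
    have "z \<in> W21" unfolding z_def[abs_def] by (rule W21_lincomb[OF yW w_W21])
    moreover have "solves_ae a lam (\<lambda>_. 0) z"
      by (rule solves_ae_lincomb[OF yW w_W21 sy w_solves, of z 1 "- y 0"]) (simp_all add: z_def)
    moreover have "z 0 = 0" "z 1 = 0" using yper w_endpoints by (simp_all add: z_def)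
    ultimately have z: "z t = 0" if "t \<in> I01" for t
      using nonres that by (simp add: nonresonant_def X_D_def)
    have y: "y t = 0 * y t + y 0 * w t" if "t \<in> I01" for t
      using z[OF that] unfolding z_def by linarith
    have "ider y t = y 0 * ider w t" if "t \<in> I01" for t
      using ider_cong[OF y that] ider_lincomb[OF yW w_W21 that, of 0 "y 0"] by simp
    then have "y 0 * \<Delta> = ider y 1 - ider y 0"
      by (simp add: \<Delta>(1) right_diff_distrib)
    then have "y 0 = 0" using yper \<Delta>(2) by simp
    then have "y t = 0" using y[OF t] by simp
    then show "x t = (LINT s:I01|lebesgue. (G t s - w t * w s / \<Delta>) * \<sigma> s)"
      by (simp add: y_def v_def)
  qed
qed

end

lemma greens_function_unique:
  assumes G: "is_greens_function X a lam G" and H: "is_greens_function X a lam H"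
    and ts: "t \<in> I01" "s \<in> I01"
  shows "G t s = H t s"
proof (rule continuous_kernel_unique[OF _ _ _ ts(2)])
  show "continuous_on I01 (G t)" "continuous_on I01 (H t)"
    using G H by (auto simp: is_greens_function_def intro: continuous_on_section ts(1))
  fix \<sigma> :: "real \<Rightarrow> real" assume \<sigma>: "\<sigma> absolutely_integrable_on I01"
  show "(LINT s:I01|lebesgue. G t s * \<sigma> s) = (LINT s:I01|lebesgue. H t s * \<sigma> s)"
    using is_greens_functionD(3)[OF H \<sigma> is_greens_functionD(1,2)[OF G \<sigma>] ts(1)] .
qed

theorem theorem4p10:
  fixes a r1 r2 :: "real \<Rightarrow> real" and lam \<Delta> :: real and G_D :: "real \<Rightarrow> real \<Rightarrow> real"
  assumes a: "a absolutely_integrable_on I01"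
    and nonres: "nonresonant X_D a lam"
    and G_D: "is_greens_function X_D a lam G_D"
    and r1: "r1 \<in> W21" "solves_ae a lam (\<lambda>_. 0) r1" "r1 0 = 1" "r1 1 = 0"
    and r2: "r2 \<in> W21" "solves_ae a lam (\<lambda>_. 0) r2" "r2 0 = 0" "r2 1 = 1"
    and Delta_def: "\<Delta> = 2 * ider r1 1 + ider r2 1 - ider r1 0"
    and Delta_nz: "\<Delta> \<noteq> 0"
  shows "(\<exists>G_P. is_greens_function X_P a lam G_P) \<and>
    (\<forall>G_P. is_greens_function X_P a lam G_P \<longrightarrow>
      (\<forall>t\<in>I01. \<forall>s\<in>I01.
         G_P t s = G_D t s + (r1 t + r2 t) / \<Delta> * (bdry_deriv_t G_D 0 s - bdry_deriv_t G_D 1 s) \<and>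
         G_P t s = G_D t s + (bdry_deriv_s G_D t 1 - bdry_deriv_s G_D t 0) / \<Delta> *
                               (bdry_deriv_t G_D 0 s - bdry_deriv_t G_D 1 s)))"
proof -
  interpret dirichlet_basis a r1 r2 lam
    by unfold_locales (fact a r1 r2)+
  have G_eq: "\<forall>t\<in>I01. \<forall>s\<in>I01. G_D t s = dirichlet_kernel t s"
    by (intro ballI dirichlet_greens_function_eq[OF G_D])
  have P: "is_greens_function X_P a lam (\<lambda>t s. G_D t s - w t * w s / \<Delta>)"
    using nonres G_D Delta_nz
    by (intro periodic_greens_function) (simp_all add: Delta_def w_slope_jump)
  show ?thesis
  proof (intro conjI[OF exI[of _ "\<lambda>t s. G_D t s - w t * w s / \<Delta>"]] P allI impI ballI)
    fix G_P t s
    assume G_P: "is_greens_function X_P a lam G_P" and t: "t \<in> I01" and s: "s \<in> I01"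
    have "- r1 s - r2 s = - w s" by (simp add: w_def)
    then have "G_P t s = G_D t s + w t / \<Delta> * (- r1 s - r2 s)"
      using greens_function_unique[OF G_P P t s] by simp
    moreover have "bdry_deriv_t G_D 0 s = - r1 s" "bdry_deriv_t G_D 1 s = r2 s"
      "bdry_deriv_s G_D t 0 = - r1 t" "bdry_deriv_s G_D t 1 = r2 t"
      using bdry_deriv_t_eq[OF G_eq s] bdry_deriv_s_eq[OF G_eq t] by simp_all
    ultimately show "G_P t s = G_D t s + (r1 t + r2 t) / \<Delta> * (bdry_deriv_t G_D 0 s - bdry_deriv_t G_D 1 s) \<and>
        G_P t s = G_D t s + (bdry_deriv_s G_D t 1 - bdry_deriv_s G_D t 0) / \<Delta> *
                               (bdry_deriv_t G_D 0 s - bdry_deriv_t G_D 1 s)"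
      by (simp add: w_def add.commute)
  qed
qed

end
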